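(* Let $(\Gamma,Z,\Omega)$ be a finite, integral, convergent, uncoupled BPS structure and let $\xi\in\mathbb T$. A solution of the meromorphic Riemann-Hilbert problem attached to $(\Gamma,Z,\Omega)$ and $\xi$ (described in the context), when it exists, is unique if and only if the orders of zero/pole at the critical points are specified; that is, two solutions $\{Y_{\beta,r}\}$ and $\{Y'_{\beta,r}\}$ coincide if and only if, for every $\beta\in\Gamma$ and every non-active ray $r$, $Y_{\beta,r}$ and $Y'_{\beta,r}$ have the same order of vanishing (counted negatively for poles) at every point of $\mathbb H_r$ of the form $\frac{Z(\gamma)}{\theta(\gamma)+2k\pi i}$, $\gamma\in\Gamma$, $k\in\mathbb Z$.
   Context: A BPS structure $(\Gamma,Z,\Omega)$ is: a lattice $\Gamma\simeq\mathbb Z^{n}$ with an integral bilinear skew-symmetric pairing $\langle-,-\rangle:\Gamma\times\Gamma\to\mathbb Z$; a homomorphism $Z:\Gamma\to\mathbb C$; a map $\Omega:\Gamma\to\mathbb Q$ with $\Omega(-\alpha)=\Omega(\alpha)$, such that for some norm on $\Gamma\otimes\mathbb R$ and some $C>0$, $|Z(\alpha)|>C\|\alpha\|$ whenever $\Omega(\alpha)\ne0$. An active class is $\gamma$ with $\Omega(\gamma)\neq0$; its active ray is $\ell_\gamma=Z(\gamma)\mathbb R_{>0}\subset\mathbb C^*$. A ray that is not active is called generic (non-active). The structure is integral if $\Omega$ is $\mathbb Z$-valued; uncoupled if $\langle\gamma,\delta\rangle=0$ for all active $\gamma,\delta$; convergent if $\sum_\gamma|\Omega(\gamma)|e^{-\lambda|Z(\gamma)|}<\infty$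 for some $\lambda>0$; finite if there are finitely many active classes. The twisted torus is $\mathbb T=\{\xi:\Gamma\to\mathbb C^*:\xi(\alpha+\beta)=(-1)^{\langle\alpha,\beta\rangle}\xi(\alpha)\xi(\beta)\}$. For $\xi\in\mathbb T$, $\theta=\ln\xi:\Gamma\to\mathbb C$ uses the branch with imaginary part in $[0,2\pi)$. For a ray $l$, $\mathbb H_l=\{v z: v\in l,\ z\in\mathbb C^*,\ -\pi/2<\arg z<\pi/2\}$. Meromorphic Riemann-Hilbert problem: find, for each $\beta\in\Gamma$ and each non-active ray $r$, a meromorphic function $Y_{\beta,r}:\mathbb H_r\to\mathbb{CP}^1$ such that: (RH0) $Y_{\beta,r}$ is holomorphic and $\mathbb C^*$-valued away from a finite number of zeroes or poles located at points of the form $t=\frac{Z(\gamma)}{\theta(\gamma)+2k\pi i}$, $\gamma\in\Gamma$, $k\in\mathbb Z$ (the critical points); (RH1) if generic rays $r_1\ne r_2$ form the boundary rays of a convex sector $\Delta\subset\mathbb C^*$, taken in clockwise order, then for all $t\in\mathbb H_{r_1}\cap\mathbb H_{r_2}$, $Y_{\beta,r_1}(t)=Y_{\beta,r_2}(t)\prod_{Z(\gamma)\in\Delta}(1-\xi(\gamma)e^{-Z(\gamma)/t})^{\Omega(\gamma)\langle\beta,\gamma\rangle}$; (RH2) $Y_{\beta,r}(t)\to1$ as $t\to0$, $t\in\mathbb H_r$; (RH3) there is $k=k(\beta,r)$ such that $|t|^{-k}<|Y_{\beta,r}(t)|<|t|^k$ for all $t\in\mathbb H_r$ with $|t|\gg0$;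 where (RH2) and (RH3) are required away from the finitely many critical points of $Y_{\beta,r}$. *)

theory Defs
  imports "HOL-Complex_Analysis.Complex_Analysis"
begin

section \<open>BPS structures\<close>

text \<open>
  The lattice \<open>\<Gamma>\<close> is an additive abelian group that is isomorphic to \<open>\<int>\<^sup>n\<close>. Vectors of length \<open>n\<close> are
  functions on \<open>nat\<close> vanishing from \<open>n\<close> on, so the rank \<open>n\<close> is an arbitrary natural number.
\<close>

definition coord_space :: "nat \<Rightarrow> (nat \<Rightarrow> 'a::zero) set" where
  "coord_space n = {x. \<forall>i\<ge>n. x i = 0}"

definition lattice_coords :: "nat \<Rightarrow> ('g::ab_group_add \<Rightarrow> nat \<Rightarrow> int) \<Rightarrow> bool" where
  "lattice_coords n c \<longleftrightarrow>
     bij_betw c UNIV (coord_space n) \<and> (\<forall>\<alpha> \<beta>. c (\<alpha> + \<beta>) = (\<lambda>i. c \<alpha> i + c \<beta> i))"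

definition is_norm_on_coords :: "nat \<Rightarrow> ((nat \<Rightarrow> real) \<Rightarrow> real) \<Rightarrow> bool" where
  "is_norm_on_coords n N \<longleftrightarrow>
     (\<forall>x\<in>coord_space n. 0 \<le> N x \<and> (N x = 0 \<longleftrightarrow> x = (\<lambda>i. 0))) \<and>
     (\<forall>x\<in>coord_space n. \<forall>s. N (\<lambda>i. s * x i) = \<bar>s\<bar> * N x) \<and>
     (\<forall>x\<in>coord_space n. \<forall>y\<in>coord_space n. N (\<lambda>i. x i + y i) \<le> N x + N y)"

text \<open>\<open>\<nu>\<close> is the restriction to \<open>\<Gamma>\<close> of some norm on \<open>\<Gamma> \<otimes> \<real>\<close>, the latter being identified with
  \<open>\<real>\<^sup>n\<close> through integral coordinates.\<close>

definition is_lattice_norm :: "('g::ab_group_add \<Rightarrow> real) \<Rightarrow> bool" where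
  "is_lattice_norm \<nu> \<longleftrightarrow>
     (\<exists>n c N. lattice_coords n c \<and> is_norm_on_coords n N \<and>
        (\<forall>\<alpha>. \<nu> \<alpha> = N (\<lambda>i. real_of_int (c \<alpha> i))))"

locale bps_structure =
  fixes pairing :: "'g::ab_group_add \<Rightarrow> 'g \<Rightarrow> int"
    and Z :: "'g \<Rightarrow> complex"
    and \<Omega> :: "'g \<Rightarrow> rat"
  assumes lattice: "\<exists>n (c :: 'g \<Rightarrow> nat \<Rightarrow> int). lattice_coords n c"
    and pairing_add_left: "pairing (\<alpha> + \<beta>) \<gamma> = pairing \<alpha> \<gamma> + pairing \<beta> \<gamma>"
    and pairing_add_right: "pairing \<alpha> (\<beta> + \<gamma>) = pairing \<alpha> \<beta> + pairing \<alpha> \<gamma>"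
    and pairing_skew: "pairing \<alpha> \<beta> = - pairing \<beta> \<alpha>"
    and Z_add: "Z (\<alpha> + \<beta>) = Z \<alpha> + Z \<beta>"
    and \<Omega>_minus: "\<Omega> (- \<alpha>) = \<Omega> \<alpha>"
    and support_property:
      "\<exists>\<nu> C. is_lattice_norm \<nu> \<and> C > 0 \<and> (\<forall>\<alpha>. \<Omega> \<alpha> \<noteq> 0 \<longrightarrow> norm (Z \<alpha>) > C * \<nu> \<alpha>)"

definition active_classes :: "('g \<Rightarrow> rat) \<Rightarrow> 'g set" where
  "active_classes \<Omega> = {\<gamma>. \<Omega> \<gamma> \<noteq> 0}"

definition bps_finite :: "('g \<Rightarrow> rat) \<Rightarrow> bool" where
  "bps_finite \<Omega> \<longleftrightarrow> finite (active_classes \<Omega>)"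

definition bps_integral :: "('g \<Rightarrow> rat) \<Rightarrow> bool" where
  "bps_integral \<Omega> \<longleftrightarrow> (\<forall>\<gamma>. \<Omega> \<gamma> \<in> \<int>)"

definition bps_uncoupled :: "('g \<Rightarrow> 'g \<Rightarrow> int) \<Rightarrow> ('g \<Rightarrow> rat) \<Rightarrow> bool" where
  "bps_uncoupled pairing \<Omega> \<longleftrightarrow>
     (\<forall>\<gamma>\<in>active_classes \<Omega>. \<forall>\<delta>\<in>active_classes \<Omega>. pairing \<gamma> \<delta> = 0)"

definition bps_convergent :: "('g \<Rightarrow> complex) \<Rightarrow> ('g \<Rightarrow> rat) \<Rightarrow> bool" where
  "bps_convergent Z \<Omega> \<longleftrightarrow>
     (\<exists>c>0. (\<lambda>\<gamma>. \<bar>real_of_rat (\<Omega> \<gamma>)\<bar> * exp (- c * norm (Z \<gamma>))) summable_on UNIV)"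

definition twisted_torus :: "('g::ab_group_add \<Rightarrow> 'g \<Rightarrow> int) \<Rightarrow> ('g \<Rightarrow> complex) set" where
  "twisted_torus pairing =
     {\<xi>. (\<forall>\<alpha>. \<xi> \<alpha> \<noteq> 0) \<and> (\<forall>\<alpha> \<beta>. \<xi> (\<alpha> + \<beta>) = (-1) powi pairing \<alpha> \<beta> * \<xi> \<alpha> * \<xi> \<beta>)}"

section \<open>Rays, half-planes and sectors\<close>

definition ray :: "complex \<Rightarrow> complex set" where
  "ray v = {of_real s * v | s. s > 0}"

definition generic_rays :: "('g \<Rightarrow> complex) \<Rightarrow> ('g \<Rightarrow> rat) \<Rightarrow> complex set set" where
  "generic_rays Z \<Omega> = {ray v | v. v \<noteq> 0} - {ray (Z \<gamma>) | \<gamma>. \<gamma> \<in> active_classes \<Omega>}"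

definition half_plane :: "complex set \<Rightarrow> complex set" where
  "half_plane l = {v * z | v z. v \<in> l \<and> z \<noteq> 0 \<and> - pi / 2 < Arg z \<and> Arg z < pi / 2}"

text \<open>
  \<open>\<Delta>\<close> is the convex sector swept out when turning clockwise from \<open>r\<^sub>1\<close> to \<open>r\<^sub>2\<close>; convexity is the
  bound \<open>\<phi> \<le> \<pi>\<close> on the opening angle. The sector is taken to be open, but below its boundary rays are
  never active, so they do not affect which active classes lie in it.
\<close>

definition clockwise_convex_sector :: "complex set \<Rightarrow> complex set \<Rightarrow> complex set \<Rightarrow> bool" where
  "clockwise_convex_sector r\<^sub>1 r\<^sub>2 \<Delta> \<longleftrightarrow>
     (\<exists>u \<phi>. u \<noteq> 0 \<and> 0 < \<phi> \<and> \<phi> \<le> pi \<and> r\<^sub>1 = ray u \<and> r\<^sub>2 = ray (u * cis (- \<phi>)) \<and>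
        \<Delta> = {of_real s * u * cis (- \<psi>) | s \<psi>. s > 0 \<and> 0 < \<psi> \<and> \<psi> < \<phi>})"

section \<open>The meromorphic Riemann-Hilbert problem\<close>

text \<open>The branch of the logarithm with imaginary part in \<open>[0, 2\<pi>)\<close>.\<close>

definition Ln2pi :: "complex \<Rightarrow> complex" where
  "Ln2pi z = Complex (ln (norm z)) (Arg2pi z)"

text \<open>
  If the denominator below vanishes, the quotient is \<open>0\<close> by convention, and \<open>0\<close> lies in no half-plane
  \<open>half_plane r\<close>; so these degenerate values play no role.
\<close>

definition critical_points :: "('g \<Rightarrow> complex) \<Rightarrow> ('g \<Rightarrow> complex) \<Rightarrow> complex set" where
  "critical_points Z \<xi> =
     {Z \<gamma> / (Ln2pi (\<xi> \<gamma>) + 2 * of_int k * of_real pi * \<i>) | \<gamma> k. True}"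

definition zeros_and_poles :: "(complex \<Rightarrow> complex) \<Rightarrow> complex set \<Rightarrow> complex set" where
  "zeros_and_poles f A = {t \<in> A. f t = 0 \<or> is_pole f t}"

text \<open>
  Only active classes are kept in the product: the factors of all other classes have exponent \<open>0\<close>.
  For an integral structure the exponent \<open>\<Omega>(\<gamma>)\<langle>\<beta>,\<gamma>\<rangle>\<close> is an integer and the floor merely converts
  its type.
\<close>

definition wall_crossing_factor ::
    "('g \<Rightarrow> 'g \<Rightarrow> int) \<Rightarrow> ('g \<Rightarrow> complex) \<Rightarrow> ('g \<Rightarrow> rat) \<Rightarrow> ('g \<Rightarrow> complex) \<Rightarrow>
      'g \<Rightarrow> complex set \<Rightarrow> complex \<Rightarrow> complex" where
  "wall_crossing_factor pairing Z \<Omega> \<xi> \<beta> \<Delta> t =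
     (\<Prod>\<gamma> | \<gamma> \<in> active_classes \<Omega> \<and> Z \<gamma> \<in> \<Delta>.
        (1 - \<xi> \<gamma> * exp (- Z \<gamma> / t)) powi \<lfloor>\<Omega> \<gamma> * of_int (pairing \<beta> \<gamma>)\<rfloor>)"

text \<open>
  A meromorphic map \<open>\<H>\<^sub>r \<rightarrow> \<complex>\<P>\<^sup>1\<close> (not identically \<open>\<infinity>\<close>) is represented by the unique function that is
  \<open>nicely_meromorphic_on\<close> \<open>\<H>\<^sub>r\<close>, i.e. that is continuous at every non-pole and has the dummy value \<open>0\<close>
  at its poles. Two such maps coincide iff their representatives agree on \<open>\<H>\<^sub>r\<close>.

  The jump condition \<open>RH1\<close> is an identity of meromorphic functions. At isolated points its right-hand
  side may be a product of the form \<open>0 \<cdot> \<infinity>\<close>, and there the values of the representatives need not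
  multiply correctly. This is why it is stated up to a sparse set of points, which by continuity
  determines both sides as \<open>\<complex>\<P>\<^sup>1\<close>-valued maps on the whole overlap.
\<close>

locale meromorphic_RH_solution =
  fixes pairing :: "'g::ab_group_add \<Rightarrow> 'g \<Rightarrow> int"
    and Z :: "'g \<Rightarrow> complex"
    and \<Omega> :: "'g \<Rightarrow> rat"
    and \<xi> :: "'g \<Rightarrow> complex"
    and Y :: "'g \<Rightarrow> complex set \<Rightarrow> complex \<Rightarrow> complex"
  assumes meromorphic:
      "r \<in> generic_rays Z \<Omega> \<Longrightarrow> Y \<beta> r nicely_meromorphic_on half_plane r"
    and RH0_holomorphic:
      "r \<in> generic_rays Z \<Omega> \<Longrightarrow>
         Y \<beta> r holomorphic_on (half_plane r - zeros_and_poles (Y \<beta> r) (half_plane r))"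
    and RH0_finite:
      "r \<in> generic_rays Z \<Omega> \<Longrightarrow> finite (zeros_and_poles (Y \<beta> r) (half_plane r))"
    and RH0_critical:
      "r \<in> generic_rays Z \<Omega> \<Longrightarrow>
         zeros_and_poles (Y \<beta> r) (half_plane r) \<subseteq> critical_points Z \<xi>"
    and RH1:
      "\<lbrakk>r\<^sub>1 \<in> generic_rays Z \<Omega>; r\<^sub>2 \<in> generic_rays Z \<Omega>; r\<^sub>1 \<noteq> r\<^sub>2; clockwise_convex_sector r\<^sub>1 r\<^sub>2 \<Delta>\<rbrakk> \<Longrightarrow>
         \<forall>\<^sub>\<approx>t\<in>half_plane r\<^sub>1 \<inter> half_plane r\<^sub>2.
           Y \<beta> r\<^sub>1 t = Y \<beta> r\<^sub>2 t * wall_crossing_factor pairing Z \<Omega> \<xi> \<beta> \<Delta> t"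
    and RH2:
      "r \<in> generic_rays Z \<Omega> \<Longrightarrow>
         (Y \<beta> r \<longlongrightarrow> 1) (at 0 within (half_plane r - zeros_and_poles (Y \<beta> r) (half_plane r)))"
    and RH3:
      "r \<in> generic_rays Z \<Omega> \<Longrightarrow>
         \<exists>k::real. \<forall>\<^sub>F t in at_infinity.
           t \<in> half_plane r - zeros_and_poles (Y \<beta> r) (half_plane r) \<longrightarrow>
           norm t powr (- k) < norm (Y \<beta> r t) \<and> norm (Y \<beta> r t) < norm t powr k"

end

theory Submission
  imports Defs
begin

text \<open>
  For two solutions with the same orders, the quotients \<open>Y\<^sub>\<beta>\<^sub>,\<^sub>r / Y'\<^sub>\<beta>\<^sub>,\<^sub>r\<close> are holomorphic and
  nowhere zero on \<open>\<H>\<^sub>r\<close>, and the jumps of \<open>RH1\<close> cancel in them. Hence they glue to a nowhere vanishing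
  holomorphic function on \<open>\<complex>\<^sup>*\<close>. It extends to \<open>0\<close> with value \<open>1\<close> by \<open>RH2\<close>, and it has at most
  polynomial growth at infinity by \<open>RH3\<close>. By Liouville's theorem it is a polynomial without zeros,
  so it is the constant \<open>1\<close>.
\<close>

section \<open>Entire functions of polynomial growth\<close>

text \<open>Liouville's theorem turns \<open>f\<close> into a polynomial of degree at most
  \<open>n\<close>, namely its Taylor polynomial at 0. A nonzero coefficient of positive degree
  would give it a root, by the fundamental theorem of algebra.\<close>

lemma entire_nonzero_polynomial_growth_constant:
  assumes hol: "f holomorphic_on UNIV" and nz: "\<And>z. f z \<noteq> 0"
    and growth: "\<And>z. A \<le> norm z \<Longrightarrow> norm (f z) \<le> norm z ^ n"
  shows "f z = f 0"
proof -
  define a where "a k = (deriv ^^ k) f 0 / fact k" for k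
  have f: "f w = (\<Sum>k\<le>n. a k * w ^ k)" for w
    unfolding a_def by (rule Liouville_polynomial[OF hol, of A 1]) (use growth in auto)
  have "a k = 0" if "k \<in> {1..n}" for k
  proof (rule ccontr)
    assume "a k \<noteq> 0"
    with that have "a 0 = 0 \<or> (\<exists>i\<in>{1..n}. a i \<noteq> 0)" by blast
    then obtain w where "(\<Sum>k\<le>n. a k * w ^ k) = 0"
      by (rule fundamental_theorem_of_algebra)
    with f nz show False by metis
  qed
  then have "f w = (\<Sum>k\<le>n. if k = 0 then a 0 else 0)" for w
    unfolding f by (intro sum.cong) auto
  then show ?thesis by simp
qed

text \<open>The pieces \<open>q i\<close> define one function on the punctured plane. The limits at
  0 make the origin a removable singularity, and the growth bounds, finitely many, merge into a
  single polynomial bound. The preceding lemma then leaves only the value at the origin.\<close>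

lemma glued_function_eq_one:
  fixes U :: "'i \<Rightarrow> complex set" and q :: "'i \<Rightarrow> complex \<Rightarrow> complex"
  assumes fin: "finite I" and cover: "(\<Union>i\<in>I. U i) = - {0}"
    and op: "\<And>i. i \<in> I \<Longrightarrow> open (U i)"
    and hol: "\<And>i. i \<in> I \<Longrightarrow> q i holomorphic_on U i"
    and nz: "\<And>i z. i \<in> I \<Longrightarrow> z \<in> U i \<Longrightarrow> q i z \<noteq> 0"
    and compat: "\<And>i j z. i \<in> I \<Longrightarrow> j \<in> I \<Longrightarrow> z \<in> U i \<Longrightarrow> z \<in> U j \<Longrightarrow> q i z = q j z"
    and lim: "\<And>i. i \<in> I \<Longrightarrow> (q i \<longlongrightarrow> 1) (at 0 within U i)"
    and growth: "\<And>i. i \<in> I \<Longrightarrow> \<exists>k::real. \<forall>\<^sub>F z in at_infinity. z \<in> U i \<longrightarrow> norm (q i z) \<le> norm z powr k"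
    and "i \<in> I" "z \<in> U i"
  shows "q i z = 1"
proof -
  \<comment> \<open>By \<open>compat\<close> the choice of index does not affect the value. At 0,
    which no \<open>U i\<close> contains, the common limit is prescribed.\<close>
  define F where "F z = (if z = 0 then 1 else q (SOME i. i \<in> I \<and> z \<in> U i) z)" for z
  have F: "F z = q i z" if "i \<in> I" "z \<in> U i" for i z
  proof -
    have "(SOME i. i \<in> I \<and> z \<in> U i) \<in> I \<and> z \<in> U (SOME i. i \<in> I \<and> z \<in> U i)"
      using that by (intro someI_ex[of "\<lambda>i. i \<in> I \<and> z \<in> U i"]) blast
    moreover have "z \<noteq> 0" using cover that by blast
    ultimately show ?thesis using compat[OF _ that(1) _ that(2)] unfolding F_def by simp
  qed
  have F0: "F 0 = 1" by (simp add: F_def)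
  have Fnz: "F z \<noteq> 0" for z
  proof (cases "z = 0")
    case False
    then obtain i where "i \<in> I" "z \<in> U i" using cover by blast
    then show ?thesis using F nz by simp
  qed (simp add: F0)
  have "F holomorphic_on U i" if "i \<in> I" for i
    using hol[OF that] by (rule holomorphic_transform) (use F that in auto)
  then have "F holomorphic_on (\<Union>i\<in>I. U i)"
    using op by (intro holomorphic_on_UN_open) auto
  then have hol_punctured: "F holomorphic_on UNIV - {0}"
    by (simp add: cover Compl_eq_Diff_UNIV)
  \<comment> \<open>Each limit is taken only within its \<open>U i\<close>. Since \<open>I\<close>
    is finite, one punctured neighbourhood of 0 serves all of them, and the sets \<open>U i\<close>
    cover it.\<close>
  have "(F \<longlongrightarrow> 1) (at 0)"
  proof (rule topological_tendstoI)
    fix V :: "complex set" assume V: "open V" "1 \<in> V"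
    have "\<forall>\<^sub>F z in at 0. z \<in> U i \<longrightarrow> q i z \<in> V" if "i \<in> I" for i
      using topological_tendstoD[OF lim[OF that] V] by (simp add: eventually_at_filter eventually_mono)
    then have "\<forall>\<^sub>F z in at 0. \<forall>i\<in>I. z \<in> U i \<longrightarrow> q i z \<in> V"
      using fin by (simp add: eventually_ball_finite_distrib)
    moreover have "\<forall>\<^sub>F z in at (0::complex). z \<noteq> 0" by (simp add: eventually_neq_at_within)
    ultimately show "\<forall>\<^sub>F z in at 0. F z \<in> V"
    proof eventually_elim
      case (elim z)
      then obtain i where "i \<in> I" "z \<in> U i" using cover by blast
      then show ?case using elim F by simp
    qed
  qed
  then have entire: "F holomorphic_on UNIV"
    by (intro no_isolated_singularity'[of "{0}", OF _ hol_punctured]) (auto simp: F0)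
  obtain k where k: "\<And>i. i \<in> I \<Longrightarrow> \<forall>\<^sub>F z in at_infinity. z \<in> U i \<longrightarrow> norm (q i z) \<le> norm z powr k i"
    using growth by metis
  \<comment> \<open>A single natural exponent that dominates all \<open>k i\<close>, the form of
    bound that Liouville's theorem asks for.\<close>
  define n where "n = nat \<lceil>Max (insert 0 (k ` I))\<rceil>"
  have kn: "k i \<le> real n" if "i \<in> I" for i
  proof -
    have "k i \<le> Max (insert 0 (k ` I))" using fin that by (intro Max_ge) auto
    also have "\<dots> \<le> real n" unfolding n_def by linarith
    finally show ?thesis .
  qed
  have "\<forall>\<^sub>F z in at_infinity. \<forall>i\<in>I. z \<in> U i \<longrightarrow> norm (q i z) \<le> norm z powr k i"
    using k fin by (simp add: eventually_ball_finite_distrib)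
  \<comment> \<open>Outside the unit disc \<open>powr\<close> increases with the exponent, so each
    \<open>k i\<close> can be replaced by \<open>n\<close>.\<close>
  moreover have "\<forall>\<^sub>F z in at_infinity. 1 \<le> norm (z::complex)"
    by (auto simp: eventually_at_infinity)
  ultimately have "\<forall>\<^sub>F z in at_infinity. norm (F z) \<le> norm z ^ n"
  proof eventually_elim
    case (elim z)
    then have "z \<noteq> 0" by auto
    then obtain i where i: "i \<in> I" "z \<in> U i" using cover by blast
    then have "norm (F z) \<le> norm z powr k i" using elim F by simp
    also have "\<dots> \<le> norm z powr real n" using elim kn i by (intro powr_mono) auto
    also have "\<dots> = norm z ^ n" using \<open>z \<noteq> 0\<close> by (simp add: powr_realpow)
    finally show ?case .
  qed
  then obtain A where "\<And>z. A \<le> norm z \<Longrightarrow> norm (F z) \<le> norm z ^ n"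
    by (auto simp: eventually_at_infinity)
  then have "F z = F 0"
    using entire_nonzero_polynomial_growth_constant[OF entire] Fnz by blast
  then show ?thesis using F F0 \<open>i \<in> I\<close> \<open>z \<in> U i\<close> by simp
qed

section \<open>Quotients of meromorphic functions\<close>

text \<open>The value of such a function at a point is determined by its values nearby: it is 0 at a
  pole and the limit elsewhere. This removes the isolated exceptional points from the identities
  below.\<close>

lemma nicely_meromorphic_eqI:
  assumes "f nicely_meromorphic_on A" "g nicely_meromorphic_on A" "z \<in> A"
    and ev: "\<forall>\<^sub>F w in at z. f w = g w"
  shows "f z = g z"
proof -
  have pole: "is_pole f z \<longleftrightarrow> is_pole g z" by (rule is_pole_cong[OF ev refl])
  have f: "is_pole f z \<and> f z = 0 \<or> f \<midarrow>z\<rightarrow> f z" and g: "is_pole g z \<and> g z = 0 \<or> g \<midarrow>z\<rightarrow> g z"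
    using assms(1-3) by (auto simp: nicely_meromorphic_on_def)
  show ?thesis
  proof (cases "is_pole f z")
    case True
    then have "\<not> f \<midarrow>z\<rightarrow> f z" "\<not> g \<midarrow>z\<rightarrow> g z"
      using pole not_tendsto_and_filterlim_at_infinity unfolding is_pole_def
      by (metis at_neq_bot)+
    with f g show ?thesis by simp
  next
    case False
    with f g pole have "f \<midarrow>z\<rightarrow> f z" "g \<midarrow>z\<rightarrow> g z" by auto
    moreover from this(1) have "g \<midarrow>z\<rightarrow> f z" using tendsto_cong[OF ev] by simp
    ultimately show ?thesis using LIM_unique by blast
  qed
qed

lemma analytic_at_outside_zeros_and_poles:
  assumes "f nicely_meromorphic_on A" "z \<in> A - zeros_and_poles f A"
  shows "f analytic_on {z}" "f z \<noteq> 0"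
  using assms nicely_meromorphic_on_imp_analytic_at[of f A z] by (auto simp: zeros_and_poles_def)

lemma eventually_notin_finite:
  fixes S :: "'a::t1_space set"
  shows "finite S \<Longrightarrow> \<forall>\<^sub>F w in at z. w \<notin> S"
  using islimpt_finite islimpt_iff_eventually by blast

lemma eventually_nonzero:
  assumes "open A" "finite (zeros_and_poles f A)" "z \<in> A"
  shows "\<forall>\<^sub>F w in at z. f w \<noteq> 0"
proof -
  have "\<forall>\<^sub>F w in at z. w \<notin> zeros_and_poles f A"
    using assms(2) by (rule eventually_notin_finite)
  moreover have "\<forall>\<^sub>F w in at z. w \<in> A"
    using assms by (simp add: eventually_at_in_open')
  ultimately show ?thesis
    by eventually_elim (auto simp: zeros_and_poles_def)
qed

text \<open>Equal orders cancel, so the quotient has order 0 at every point. Its singularities in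
  \<open>A\<close> are therefore removable, and the corrected function has no zeros there.\<close>

lemma quotient_same_zorder:
  fixes f g :: "complex \<Rightarrow> complex"
  assumes A: "open A" and f: "f nicely_meromorphic_on A" and g: "g nicely_meromorphic_on A"
    and fin: "finite (zeros_and_poles f A)" "finite (zeros_and_poles g A)"
    and ord: "\<And>z. z \<in> A \<Longrightarrow> zorder f z = zorder g z"
  defines "q \<equiv> remove_sings (\<lambda>z. f z / g z)"
  shows "q holomorphic_on A" "\<And>z. z \<in> A \<Longrightarrow> q z \<noteq> 0"
    "\<And>z. z \<in> A - zeros_and_poles f A - zeros_and_poles g A \<Longrightarrow> q z = f z / g z"
proof -
  have mero: "f meromorphic_on A" "g meromorphic_on A"
    using f g by (auto simp: nicely_meromorphic_on_def)
  then have q_nice: "q nicely_meromorphic_on A"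
    unfolding q_def by (intro remove_sings_nicely_meromorphic meromorphic_on_divide)
  have *: "q analytic_on {z} \<and> q z \<noteq> 0" if z: "z \<in> A" for z
  proof -
    have at: "f meromorphic_on {z}" "g meromorphic_on {z}" "q meromorphic_on {z}"
      using mero q_nice z by (auto simp: nicely_meromorphic_on_def intro: meromorphic_on_subset)
    have iso: "isolated_singularity_at (\<lambda>z. f z / g z) z"
      using at by (intro meromorphic_on_isolated_singularity meromorphic_on_divide)
    \<comment> \<open>With finitely many zeros neither function vanishes identically near
      \<open>z\<close>, so the order of the quotient is the difference of the orders.\<close>
    have nzf: "\<forall>\<^sub>F w in at z. f w \<noteq> 0" and nzg: "\<forall>\<^sub>F w in at z. g w \<noteq> 0"
      using eventually_nonzero[OF A _ z] fin by auto
    have q_eq: "\<forall>\<^sub>F w in at z. q w = f w / g w"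
      unfolding q_def by (rule eventually_remove_sings_eq_at[OF iso])
    then have "\<forall>\<^sub>F w in at z. q w \<noteq> 0"
      using nzf nzg by eventually_elim simp
    then have nzq: "\<exists>\<^sub>F w in at z. q w \<noteq> 0" by (intro eventually_frequently) auto
    have "zorder q z = zorder (\<lambda>z. f z / g z) z"
      by (rule zorder_cong[OF q_eq refl])
    also have "\<dots> = 0"
      using zorder_divide[of f z g] at nzf nzg ord[OF z] by (simp add: eventually_frequently)
    finally have zero: "zorder q z = 0" .
    \<comment> \<open>An isolated pole would force a negative order.\<close>
    have "\<not> is_pole q z"
      using isolated_pole_imp_neg_zorder[of q z] at(3) zero
        meromorphic_on_isolated_singularity by force
    then have "q analytic_on {z}"
      using nicely_meromorphic_on_imp_analytic_at[OF q_nice z] by simp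
    with zero nzq zorder_eq_0_iff show ?thesis by blast
  qed
  then show "q holomorphic_on A"
    by (meson analytic_imp_holomorphic analytic_on_analytic_at)
  show "\<And>z. z \<in> A \<Longrightarrow> q z \<noteq> 0" using * by blast
  fix z assume "z \<in> A - zeros_and_poles f A - zeros_and_poles g A"
  then show "q z = f z / g z"
    unfolding q_def using analytic_at_outside_zeros_and_poles[OF f, of z]
      analytic_at_outside_zeros_and_poles[OF g, of z]
    by (intro remove_sings_at_analytic analytic_on_divide) auto
qed

section \<open>Half-planes of generic rays\<close>

text \<open>Multiplication by \<open>cnj v\<close> turns \<open>ray v\<close> onto the positive real
  axis, where the condition on the argument becomes positivity of the real part. Openness and
  covering can be read off from this form.\<close>

lemma half_plane_ray:
  assumes "v \<noteq> 0"
  shows "half_plane (ray v) = {t. 0 < Re (t * cnj v)}"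
proof (intro equalityI subsetI)
  fix t assume "t \<in> half_plane (ray v)"
  then obtain s z where t: "t = of_real s * v * z" "s > 0" "z \<noteq> 0" "\<bar>Arg z\<bar> < pi / 2"
    by (fastforce simp: half_plane_def ray_def)
  then have "0 < Re z" using Arg_Re_pos[of z] by blast
  have eq: "t * cnj v = of_real (s * (norm v)\<^sup>2) * z"
    by (simp add: t(1) complex_norm_square del: of_real_power)
  have "Re (t * cnj v) = s * (norm v)\<^sup>2 * Re z" unfolding eq by (simp del: of_real_power of_real_mult)
  with t \<open>0 < Re z\<close> assms show "t \<in> {t. 0 < Re (t * cnj v)}" by simp
next
  fix t assume "t \<in> {t. 0 < Re (t * cnj v)}"
  then have pos: "0 < Re (t * cnj v)" by simp
  \<comment> \<open>The witnesses are the point \<open>v\<close> of the ray and the factor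
    \<open>t / v\<close>, which differs from \<open>t * cnj v\<close> by a positive real
    factor.\<close>
  have eq: "t * cnj v = of_real ((norm v)\<^sup>2) * (t / v)"
    using assms by (simp add: complex_norm_square del: of_real_power)
  have "Re (t * cnj v) = (norm v)\<^sup>2 * Re (t / v)"
    unfolding eq by (simp del: of_real_power of_real_mult times_divide_eq_right)
  with pos have "0 < (norm v)\<^sup>2 * Re (t / v)" by (simp only:)
  then have "0 < Re (t / v)" by (simp only: zero_less_mult_iff) auto
  then have "\<bar>Arg (t / v)\<bar> < pi / 2" "t / v \<noteq> 0" using Arg_Re_pos[of "t / v"] by (blast, force)
  moreover have "v \<in> ray v" by (auto simp: ray_def intro!: exI[of _ 1])
  moreover have "t = v * (t / v)" using assms by simp
  ultimately show "t \<in> half_plane (ray v)" unfolding half_plane_def by fastforce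
qed

lemma open_half_plane_ray: "v \<noteq> 0 \<Longrightarrow> open (half_plane (ray v))"
  by (simp add: half_plane_ray open_Collect_less continuous_intros)

lemma zero_not_in_half_plane_ray: "v \<noteq> 0 \<Longrightarrow> 0 \<notin> half_plane (ray v)"
  by (simp add: half_plane_ray)

text \<open>The four half-planes are given by the signs of the real and imaginary parts of
  \<open>t * cnj u\<close>, since a quarter turn of \<open>u\<close> exchanges these parts up to
  sign. They cannot both vanish.\<close>

lemma half_planes_cover:
  assumes "u \<noteq> 0"
  shows "- {0} \<subseteq> half_plane (ray u) \<union> half_plane (ray (- u)) \<union>
    half_plane (ray (\<i> * u)) \<union> half_plane (ray (- \<i> * u))"
proof
  fix t :: complex assume "t \<in> - {0}"
  then have "t * cnj u \<noteq> 0" using assms by simp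
  then have "Re (t * cnj u) \<noteq> 0 \<or> Im (t * cnj u) \<noteq> 0" using complex_eq_iff by fastforce
  with assms show "t \<in> half_plane (ray u) \<union> half_plane (ray (- u)) \<union>
    half_plane (ray (\<i> * u)) \<union> half_plane (ray (- \<i> * u))"
    by (simp add: half_plane_ray) argo
qed

section \<open>Rays and the sectors between them\<close>

lemma ray_scale:
  assumes "s > 0"
  shows "ray (of_real s * v) = ray v"
proof (intro equalityI subsetI)
  fix t assume "t \<in> ray (of_real s * v)"
  then obtain a where "a > 0" "t = of_real (a * s) * v" by (auto simp: ray_def)
  with assms show "t \<in> ray v" unfolding ray_def by (metis (mono_tags, lifting) mem_Collect_eq mult_pos_pos)
next
  fix t assume "t \<in> ray v"
  then obtain a where "a > 0" "t = of_real a * v" by (auto simp: ray_def)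
  with assms show "t \<in> ray (of_real s * v)"
    by (auto simp: ray_def intro!: exI[of _ "a / s"])
qed

lemma sgn_eq_if_ray_eq:
  assumes "ray v = ray w"
  shows "sgn v = sgn w"
proof -
  have "v \<in> ray v" by (auto simp: ray_def intro!: exI[of _ 1])
  then have "v \<in> ray w" using assms by simp
  then obtain s where "s > 0" "v = of_real s * w" unfolding ray_def by blast
  then show ?thesis by (simp add: sgn_mult sgn_of_real)
qed

text \<open>The sign of \<open>Arg (w / v)\<close> decides which ray comes first in clockwise order.
  Opposite rays give the angle \<open>pi\<close>, which the definition of a convex sector
  admits.\<close>

lemma clockwise_convex_sector_exhaust:
  assumes "v \<noteq> 0" "w \<noteq> 0" "ray v \<noteq> ray w"
  obtains \<Delta> where "clockwise_convex_sector (ray v) (ray w) \<Delta> \<or> clockwise_convex_sector (ray w) (ray v) \<Delta>"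
proof -
  have sector: "\<exists>\<Delta>. clockwise_convex_sector (ray x) (ray y) \<Delta>"
    if "x \<noteq> 0" "0 < \<phi>" "\<phi> \<le> pi" "s > 0" "y = of_real s * (x * cis (- \<phi>))" for x y s \<phi>
    using that ray_scale[of s "x * cis (- \<phi>)"] unfolding clockwise_convex_sector_def by blast
  define \<theta> where "\<theta> = Arg (w / v)"
  define s where "s = norm (w / v)"
  have "s > 0" using assms by (simp add: s_def)
  have "w / v = of_real s * cis \<theta>" unfolding s_def \<theta>_def
    using rcis_cmod_Arg[of "w / v"] by (simp add: rcis_def)
  then have w: "w = of_real s * (v * cis \<theta>)" using assms by (simp add: field_simps)
  have bounds: "- pi < \<theta>" "\<theta> \<le> pi" using Arg_bounded[of "w / v"] by (auto simp: \<theta>_def)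
  have "\<theta> \<noteq> 0"
  proof
    assume "\<theta> = 0"
    then have "ray w = ray v" using w ray_scale[OF \<open>s > 0\<close>, of v] by simp
    with assms show False by simp
  qed
  then consider "\<theta> < 0" | "\<theta> > 0" by linarith
  then show ?thesis
  proof cases
    case 1
    then show ?thesis using sector[of v "- \<theta>" s w] that bounds w assms \<open>s > 0\<close> by auto
  next
    case 2
    have "v = of_real (1 / s) * (w * cis (- \<theta>))"
      using w \<open>s > 0\<close> by (simp add: cis_mult mult.assoc)
    then show ?thesis using sector[of w \<theta> "1 / s" v] that bounds 2 assms \<open>s > 0\<close> by auto
  qed
qed

section \<open>Existence of enough generic rays\<close>

lemma generic_raysE:
  assumes "r \<in> generic_rays Z \<Omega>"
  obtains v where "v \<noteq> 0" "r = ray v"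
  using assms by (auto simp: generic_rays_def)

lemma infinite_unit_circle: "infinite (sphere (0::complex) 1)"
proof
  assume "finite (sphere (0::complex) 1)"
  moreover have "connected (sphere (0::complex) 1)" by (rule connected_sphere) simp
  ultimately obtain a where "sphere (0::complex) 1 \<subseteq> {a}"
    using connected_finite_iff_sing by (metis empty_subsetI order_refl)
  moreover have "1 \<in> sphere (0::complex) 1" "- 1 \<in> sphere (0::complex) 1" by auto
  ultimately have "(1::complex) = a" "(- 1::complex) = a" by blast+
  then show False by simp
qed

text \<open>Finitely many active classes exclude only finitely many unit directions, even after
  allowing for quarter turns, while the unit circle is infinite. The four rays have half-planes that
  cover the punctured plane.\<close>

lemma generic_cross_exists:
  assumes "bps_finite \<Omega>"
  obtains u where "u \<noteq> 0" "ray u \<in> generic_rays Z \<Omega>" "ray (- u) \<in> generic_rays Z \<Omega>"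
    "ray (\<i> * u) \<in> generic_rays Z \<Omega>" "ray (- \<i> * u) \<in> generic_rays Z \<Omega>"
proof -
  define S where "S = (\<lambda>\<gamma>. sgn (Z \<gamma>)) ` active_classes \<Omega>"
  \<comment> \<open>A unit vector \<open>u\<close> lies in \<open>B\<close> as soon as one of its
    four quarter turns \<open>c * u\<close> points in an active direction.\<close>
  define B where "B = (\<Union>c\<in>{1, - 1, \<i>, - \<i>}. (\<lambda>s. s / c) ` S)"
  have "finite B" using assms by (simp add: B_def S_def bps_finite_def)
  then obtain u where u: "u \<in> sphere 0 1" "u \<notin> B"
    using infinite_unit_circle by (meson finite_subset subsetI)
  have gen: "ray (c * u) \<in> generic_rays Z \<Omega>" if c: "c \<in> {1, - 1, \<i>, - \<i>}" for c
  proof -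
    have norm1: "c \<noteq> 0" "norm (c * u) = 1" using c u by (auto simp: norm_mult)
    have "ray (c * u) \<noteq> ray (Z \<gamma>)" if "\<gamma> \<in> active_classes \<Omega>" for \<gamma>
    proof
      assume "ray (c * u) = ray (Z \<gamma>)"
      then have "c * u = sgn (Z \<gamma>)"
        using sgn_eq_if_ray_eq norm1 by (metis div_by_1 of_real_1 sgn_eq)
      then have "u = sgn (Z \<gamma>) / c" using norm1 by (simp add: field_simps)
      then have "u \<in> B" using c that unfolding B_def S_def by blast
      with u show False by simp
    qed
    moreover have "c * u \<noteq> 0" using norm1 by auto
    ultimately show ?thesis unfolding generic_rays_def by blast
  qed
  have "u \<noteq> 0" using u by auto
  then show ?thesis
    using gen[of 1] gen[of "- 1"] gen[of \<i>] gen[of "- \<i>"] by (intro that[of u]) simp_all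
qed

section \<open>Uniqueness\<close>

text \<open>Both solutions jump by the same wall-crossing factor, which cancels in the quotient. Any
  two distinct generic rays bound a convex sector in one of the two orders, so \<open>RH1\<close> is
  available for every pair.\<close>

lemma RH_quotients_agree_on_overlap:
  assumes Y: "meromorphic_RH_solution pairing Z \<Omega> \<xi> Y"
    and Y': "meromorphic_RH_solution pairing Z \<Omega> \<xi> Y'"
    and ord: "\<And>r t. r \<in> generic_rays Z \<Omega> \<Longrightarrow> t \<in> half_plane r \<Longrightarrow> zorder (Y \<beta> r) t = zorder (Y' \<beta> r) t"
    and gen: "r\<^sub>1 \<in> generic_rays Z \<Omega>" "r\<^sub>2 \<in> generic_rays Z \<Omega>"
    and t: "t \<in> half_plane r\<^sub>1" "t \<in> half_plane r\<^sub>2"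
  shows "remove_sings (\<lambda>z. Y \<beta> r\<^sub>1 z / Y' \<beta> r\<^sub>1 z) t = remove_sings (\<lambda>z. Y \<beta> r\<^sub>2 z / Y' \<beta> r\<^sub>2 z) t"
proof -
  interpret Y: meromorphic_RH_solution pairing Z \<Omega> \<xi> Y by (rule Y)
  interpret Y': meromorphic_RH_solution pairing Z \<Omega> \<xi> Y' by (rule Y')
  define q where "q r = remove_sings (\<lambda>z. Y \<beta> r z / Y' \<beta> r z)" for r
  have op: "open (half_plane r)" if "r \<in> generic_rays Z \<Omega>" for r
    using that open_half_plane_ray by (elim generic_raysE) simp
  have quot: "q r holomorphic_on half_plane r"
    "\<And>z. z \<in> half_plane r - zeros_and_poles (Y \<beta> r) (half_plane r)
        - zeros_and_poles (Y' \<beta> r) (half_plane r) \<Longrightarrow> q r z = Y \<beta> r z / Y' \<beta> r z"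
    if r: "r \<in> generic_rays Z \<Omega>" for r
    unfolding q_def
    using quotient_same_zorder[OF op[OF r] Y.meromorphic[OF r] Y'.meromorphic[OF r]
        Y.RH0_finite[OF r] Y'.RH0_finite[OF r] ord[OF r]] by blast+
  have sector: "q r t = q r' t"
    if r: "r \<in> generic_rays Z \<Omega>" and r': "r' \<in> generic_rays Z \<Omega>" and "r \<noteq> r'"
      and \<Delta>: "clockwise_convex_sector r r' \<Delta>" and t: "t \<in> half_plane r" "t \<in> half_plane r'"
    for r r' \<Delta>
  proof -
    let ?O = "half_plane r \<inter> half_plane r'"
    let ?W = "wall_crossing_factor pairing Z \<Omega> \<xi> \<beta> \<Delta>"
    have O: "open ?O" "t \<in> ?O" using op r r' t by auto
    define S where "S = zeros_and_poles (Y \<beta> r) (half_plane r) \<union> zeros_and_poles (Y' \<beta> r) (half_plane r)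
      \<union> zeros_and_poles (Y \<beta> r') (half_plane r') \<union> zeros_and_poles (Y' \<beta> r') (half_plane r')"
    have "finite S" unfolding S_def using Y.RH0_finite Y'.RH0_finite r r' by simp
    then have "\<forall>\<^sub>F z in at t. z \<notin> S"
      by (rule eventually_notin_finite)
    moreover have "\<forall>\<^sub>F z in at t. z \<in> ?O" using O by (rule eventually_at_in_open')
    \<comment> \<open>\<open>RH1\<close> holds off a sparse set, hence throughout some punctured
      neighbourhood of \<open>t\<close>.\<close>
    moreover have "\<forall>\<^sub>F z in at t. Y \<beta> r z = Y \<beta> r' z * ?W z" "\<forall>\<^sub>F z in at t. Y' \<beta> r z = Y' \<beta> r' z * ?W z"
      using Y.RH1[OF r r' \<open>r \<noteq> r'\<close> \<Delta>, of \<beta>] Y'.RH1[OF r r' \<open>r \<noteq> r'\<close> \<Delta>, of \<beta>] O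
      by (simp_all add: eventually_cosparse_open_eq)
    ultimately have ev: "\<forall>\<^sub>F z in at t. q r z = q r' z"
    proof eventually_elim
      case (elim z)
      have "Y \<beta> r z \<noteq> 0" using elim(1,2) by (auto simp: S_def zeros_and_poles_def)
      \<comment> \<open>The jump relation, with a nonzero left-hand side, shows that the factor is
        nonzero and may be cancelled.\<close>
      then have "?W z \<noteq> 0" using elim(3) by auto
      moreover have "q r z = Y \<beta> r z / Y' \<beta> r z" "q r' z = Y \<beta> r' z / Y' \<beta> r' z"
        using elim(1,2) quot(2)[OF r, of z] quot(2)[OF r', of z] by (auto simp: S_def)
      ultimately show ?case using elim(3,4) by simp
    qed
    have "q r nicely_meromorphic_on ?O" "q r' nicely_meromorphic_on ?O"
      using quot(1)[OF r] quot(1)[OF r'] O(1)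
      by (auto intro!: analytic_on_imp_nicely_meromorphic_on
          simp: analytic_on_open intro: holomorphic_on_subset)
    then show ?thesis using nicely_meromorphic_eqI O(2) ev by blast
  qed
  show ?thesis
  proof (cases "r\<^sub>1 = r\<^sub>2")
    case False
    obtain v where "v \<noteq> 0" "r\<^sub>1 = ray v" using gen(1) by (rule generic_raysE)
    moreover obtain w where "w \<noteq> 0" "r\<^sub>2 = ray w" using gen(2) by (rule generic_raysE)
    ultimately obtain \<Delta> where
      "clockwise_convex_sector r\<^sub>1 r\<^sub>2 \<Delta> \<or> clockwise_convex_sector r\<^sub>2 r\<^sub>1 \<Delta>"
      using clockwise_convex_sector_exhaust False by metis
    then show ?thesis
      using sector[OF gen False _ t] sector[OF gen(2,1) _ _ t(2,1)] False unfolding q_def by metis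
  qed simp
qed

text \<open>The gluing lemma is applied to the quotients, indexed by the rays themselves:
  \<open>RH2\<close> supplies the limits at 0 and \<open>RH3\<close> the growth.\<close>

lemma RH_solution_unique:
  assumes Y: "meromorphic_RH_solution pairing Z \<Omega> \<xi> Y"
    and Y': "meromorphic_RH_solution pairing Z \<Omega> \<xi> Y'"
    and fin: "bps_finite \<Omega>"
    and ord: "\<And>r t. r \<in> generic_rays Z \<Omega> \<Longrightarrow> t \<in> half_plane r \<Longrightarrow> zorder (Y \<beta> r) t = zorder (Y' \<beta> r) t"
    and r: "r \<in> generic_rays Z \<Omega>" and t: "t \<in> half_plane r"
  shows "Y \<beta> r t = Y' \<beta> r t"
proof -
  interpret Y: meromorphic_RH_solution pairing Z \<Omega> \<xi> Y by (rule Y)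
  interpret Y': meromorphic_RH_solution pairing Z \<Omega> \<xi> Y' by (rule Y')
  define q where "q r = remove_sings (\<lambda>z. Y \<beta> r z / Y' \<beta> r z)" for r
  define S where "S r = zeros_and_poles (Y \<beta> r) (half_plane r) \<union> zeros_and_poles (Y' \<beta> r) (half_plane r)" for r
  have op: "open (half_plane r)" and zero: "0 \<notin> half_plane r" if "r \<in> generic_rays Z \<Omega>" for r
    using that open_half_plane_ray zero_not_in_half_plane_ray by (auto elim!: generic_raysE)
  have quot: "q r holomorphic_on half_plane r" "\<And>z. z \<in> half_plane r \<Longrightarrow> q r z \<noteq> 0"
    "\<And>z. z \<in> half_plane r - S r \<Longrightarrow> q r z = Y \<beta> r z / Y' \<beta> r z"
    if r: "r \<in> generic_rays Z \<Omega>" for r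
    unfolding q_def S_def
    using quotient_same_zorder[OF op[OF r] Y.meromorphic[OF r] Y'.meromorphic[OF r]
        Y.RH0_finite[OF r] Y'.RH0_finite[OF r] ord[OF r]] by auto
  have finS: "finite (S r)" if "r \<in> generic_rays Z \<Omega>" for r
    using that Y.RH0_finite Y'.RH0_finite by (simp add: S_def)
  have lim: "(q r \<longlongrightarrow> 1) (at 0 within half_plane r)" if r: "r \<in> generic_rays Z \<Omega>" for r
  proof -
    have "\<forall>\<^sub>F z in at 0. z \<notin> S r"
      using finS[OF r] by (rule eventually_notin_finite)
    \<comment> \<open>A finite set misses a punctured neighbourhood of 0, so removing
      \<open>S r\<close> does not change limits at 0.\<close>
    then have ev: "\<forall>\<^sub>F z in at 0. z \<in> half_plane r - S r \<longleftrightarrow> z \<in> half_plane r"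
      by eventually_elim auto
    have "(Y \<beta> r \<longlongrightarrow> 1) (at 0 within (half_plane r - S r))" "(Y' \<beta> r \<longlongrightarrow> 1) (at 0 within (half_plane r - S r))"
      using Y.RH2[OF r, of \<beta>] Y'.RH2[OF r, of \<beta>] by (auto simp: S_def intro: tendsto_within_subset)
    then have "((\<lambda>z. Y \<beta> r z / Y' \<beta> r z) \<longlongrightarrow> 1 / 1) (at 0 within (half_plane r - S r))"
      by (intro tendsto_divide) auto
    moreover have "\<forall>\<^sub>F z in at 0 within (half_plane r - S r). Y \<beta> r z / Y' \<beta> r z = q r z"
      using quot(3)[OF r] by (simp add: eventually_at_filter)
    ultimately have "(q r \<longlongrightarrow> 1) (at 0 within (half_plane r - S r))"
      by (simp add: Lim_transform_eventually)
    then show ?thesis using ev by (rule Lim_transform_within_set)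
  qed
  have growth: "\<exists>k::real. \<forall>\<^sub>F z in at_infinity. z \<in> half_plane r \<longrightarrow> norm (q r z) \<le> norm z powr k"
    if r: "r \<in> generic_rays Z \<Omega>" for r
  proof -
    from Y.RH3[OF r, of \<beta>] obtain k where k: "\<forall>\<^sub>F z in at_infinity.
        z \<in> half_plane r - zeros_and_poles (Y \<beta> r) (half_plane r) \<longrightarrow>
        norm z powr (- k) < norm (Y \<beta> r z) \<and> norm (Y \<beta> r z) < norm z powr k" by blast
    from Y'.RH3[OF r, of \<beta>] obtain k' where k': "\<forall>\<^sub>F z in at_infinity.
        z \<in> half_plane r - zeros_and_poles (Y' \<beta> r) (half_plane r) \<longrightarrow>
        norm z powr (- k') < norm (Y' \<beta> r z) \<and> norm (Y' \<beta> r z) < norm z powr k'" by blast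
    \<comment> \<open>The exceptional points are bounded, so near infinity both estimates of
      \<open>RH3\<close> apply: the upper one for \<open>Y\<close> and the lower one for
      \<open>Y'\<close> bound the quotient.\<close>
    obtain b where b: "\<And>z. z \<in> S r \<Longrightarrow> norm z \<le> b"
      using finite_imp_bounded[OF finS[OF r]] by (auto simp: bounded_iff)
    have "\<forall>\<^sub>F z in at_infinity. z \<notin> S r"
      unfolding eventually_at_infinity by (rule exI[of _ "b + 1"]) (use b in fastforce)
    with k k' have "\<forall>\<^sub>F z in at_infinity. z \<in> half_plane r \<longrightarrow> norm (q r z) \<le> norm z powr (k + k')"
    proof eventually_elim
      case (elim z)
      show ?case
      proof
        assume z: "z \<in> half_plane r"
        then have z0: "0 < norm z" using zero[OF r] by auto
        have bd: "norm (Y \<beta> r z) \<le> norm z powr k" "norm z powr (- k') \<le> norm (Y' \<beta> r z)"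
          using elim z by (auto simp: S_def)
        have "norm (q r z) = norm (Y \<beta> r z) / norm (Y' \<beta> r z)"
          using quot(3)[OF r, of z] z elim by (simp add: norm_divide)
        also have "\<dots> \<le> norm z powr k / norm z powr (- k')"
          using bd z0 by (intro frac_le) auto
        also have "\<dots> = norm z powr (k + k')" using z0 by (simp add: powr_diff[symmetric])
        finally show "norm (q r z) \<le> norm z powr (k + k')" .
      qed
    qed
    then show ?thesis by blast
  qed
  obtain u where u: "u \<noteq> 0" "ray u \<in> generic_rays Z \<Omega>" "ray (- u) \<in> generic_rays Z \<Omega>"
    "ray (\<i> * u) \<in> generic_rays Z \<Omega>" "ray (- \<i> * u) \<in> generic_rays Z \<Omega>"
    using fin by (rule generic_cross_exists)
  \<comment> \<open>The cross covers the punctured plane; \<open>r\<close> is added so that the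
    conclusion applies to its own quotient.\<close>
  define I where "I = {r, ray u, ray (- u), ray (\<i> * u), ray (- \<i> * u)}"
  have I: "s \<in> generic_rays Z \<Omega>" if "s \<in> I" for s using that u r by (auto simp: I_def)
  have q1: "q r z = 1" if "z \<in> half_plane r" for z
  proof (rule glued_function_eq_one[of I half_plane q])
    show "(\<Union>s\<in>I. half_plane s) = - {0}"
      using half_planes_cover[OF u(1)] zero[OF I] by (auto simp: I_def)
    show "q s w = q s' w" if "s \<in> I" "s' \<in> I" "w \<in> half_plane s" "w \<in> half_plane s'" for s s' w
      unfolding q_def using RH_quotients_agree_on_overlap[OF Y Y' ord] that I by blast
  qed (use that I op quot lim growth in \<open>auto simp: I_def\<close>)
  \<comment> \<open>The quotient 1 gives equality off \<open>S r\<close>; at points of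
    \<open>S r\<close> the values follow from those nearby.\<close>
  have "\<forall>\<^sub>F z in at t. z \<notin> S r"
    using finS[OF r] by (rule eventually_notin_finite)
  moreover have "\<forall>\<^sub>F z in at t. z \<in> half_plane r" using op[OF r] t by (rule eventually_at_in_open')
  ultimately have "\<forall>\<^sub>F z in at t. Y \<beta> r z = Y' \<beta> r z"
  proof eventually_elim
    case (elim z)
    have "Y' \<beta> r z \<noteq> 0" using elim by (auto simp: S_def zeros_and_poles_def)
    moreover have "Y \<beta> r z / Y' \<beta> r z = 1" using quot(3)[OF r, of z] q1[of z] elim by simp
    ultimately show ?case by simp
  qed
  then show ?thesis
    using nicely_meromorphic_eqI[OF Y.meromorphic[OF r] Y'.meromorphic[OF r] t] by blast
qed

text \<open>By \<open>RH0\<close> the function is analytic and nonzero there. Hence equality of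
  orders at the critical points amounts to equality on the whole half-plane.\<close>

lemma zorder_eq_0_outside_critical_points:
  assumes "meromorphic_RH_solution pairing Z \<Omega> \<xi> Y" "r \<in> generic_rays Z \<Omega>"
    and "t \<in> half_plane r" "t \<notin> critical_points Z \<xi>"
  shows "zorder (Y \<beta> r) t = 0"
proof -
  interpret meromorphic_RH_solution pairing Z \<Omega> \<xi> Y by (rule assms)
  have "t \<in> half_plane r - zeros_and_poles (Y \<beta> r) (half_plane r)"
    using RH0_critical[OF assms(2)] assms by blast
  then show ?thesis
    using analytic_at_outside_zeros_and_poles meromorphic[OF assms(2)] by (intro zorder_eq_0I) blast+
qed

theorem proposition2p7:
  fixes pairing :: "'g::ab_group_add \<Rightarrow> 'g \<Rightarrow> int"
    and Z :: "'g \<Rightarrow> complex"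
    and \<Omega> :: "'g \<Rightarrow> rat"
    and \<xi> :: "'g \<Rightarrow> complex"
    and Y Y' :: "'g \<Rightarrow> complex set \<Rightarrow> complex \<Rightarrow> complex"
  assumes "bps_structure pairing Z \<Omega>"
    and "bps_finite \<Omega>"
    and "bps_integral \<Omega>"
    and "bps_convergent Z \<Omega>"
    and "bps_uncoupled pairing \<Omega>"
    and "\<xi> \<in> twisted_torus pairing"
    and "meromorphic_RH_solution pairing Z \<Omega> \<xi> Y"
    and "meromorphic_RH_solution pairing Z \<Omega> \<xi> Y'"
  shows "(\<forall>\<beta>. \<forall>r\<in>generic_rays Z \<Omega>. \<forall>t\<in>half_plane r. Y \<beta> r t = Y' \<beta> r t) \<longleftrightarrow>
         (\<forall>\<beta>. \<forall>r\<in>generic_rays Z \<Omega>. \<forall>t\<in>half_plane r \<inter> critical_points Z \<xi>.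
            zorder (Y \<beta> r) t = zorder (Y' \<beta> r) t)"
proof (intro iffI allI ballI)
  fix \<beta> r t
  assume eq: "\<forall>\<beta>. \<forall>r\<in>generic_rays Z \<Omega>. \<forall>t\<in>half_plane r. Y \<beta> r t = Y' \<beta> r t"
    and r: "r \<in> generic_rays Z \<Omega>" and t: "t \<in> half_plane r \<inter> critical_points Z \<xi>"
  \<comment> \<open>The order depends on the values in a punctured neighbourhood, so agreement on an
    open set is used.\<close>
  have "open (half_plane r)" using r open_half_plane_ray by (elim generic_raysE) simp
  then have "\<forall>\<^sub>F z in at t. z \<in> half_plane r" using t by (intro eventually_at_in_open') auto
  then have "\<forall>\<^sub>F z in at t. Y \<beta> r z = Y' \<beta> r z" by eventually_elim (use eq r in blast)
  then show "zorder (Y \<beta> r) t = zorder (Y' \<beta> r) t" by (rule zorder_cong) simp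
next
  fix \<beta> r t
  assume ord: "\<forall>\<beta>. \<forall>r\<in>generic_rays Z \<Omega>. \<forall>t\<in>half_plane r \<inter> critical_points Z \<xi>.
      zorder (Y \<beta> r) t = zorder (Y' \<beta> r) t"
    and r: "r \<in> generic_rays Z \<Omega>" and t: "t \<in> half_plane r"
  have "zorder (Y \<beta> s) z = zorder (Y' \<beta> s) z" if "s \<in> generic_rays Z \<Omega>" "z \<in> half_plane s" for s z
    using ord that zorder_eq_0_outside_critical_points[OF assms(7) that]
      zorder_eq_0_outside_critical_points[OF assms(8) that]
    by (cases "z \<in> critical_points Z \<xi>") simp_all
  then show "Y \<beta> r t = Y' \<beta> r t"
    using RH_solution_unique[OF assms(7,8,2)] r t by blast
qed

end
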